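(* Every graph class with bounded tree-independence number is polynomially $\chi$-bounded. That is, if $\mathcal{G}$ is a graph class for which there is an integer $k$ with $\mathsf{tree}\text{-}\alpha(G)\le k$ for all $G\in\mathcal{G}$, then there is a polynomial $q$ such that for every $G\in\mathcal{G}$ and every induced subgraph $G'$ of $G$, $\chi(G')\le q(\omega(G'))$.
   Context: All graphs are finite, simple, and undirected; $\chi$ and $\omega$ denote the chromatic number and the clique number. A tree decomposition of a graph $G$ is a pair $\mathcal{T}=(T,\{X_t\}_{t\in V(T)})$ where $T$ is a tree and each node $t$ is assigned a bag $X_t\subseteq V(G)$ such that every vertex of $G$ is in at least one bag, every edge of $G$ has both endpoints in some common bag, and for every $u\in V(G)$ the subgraph of $T$ induced by $\{t: u\in X_t\}$ is connected. The independence number of $\mathcal{T}$ is $\alpha(\mathcal{T})=\max_{t\in V(T)}\alpha(G[X_t])$, where $\alpha(H)$ is the maximum size of an independent set in $H$. The tree-independence number $\mathsf{tree}\text{-}\alpha(G)$ is the minimum of $\alpha(\mathcal{T})$ over all tree decompositions $\mathcal{T}$ of $G$. *)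

theory Defs
  imports "Graph_Theory.Digraph_Component" "HOL-Computational_Algebra.Polynomial"
begin

text \<open>
  Finite simple undirected graphs are the symmetric digraphs of the locale \<^term>\<open>Digraph.graph\<close>:
  finite, without loops or parallel arcs, and adjacency \<open>u \<rightarrow>\<^bsub>G\<^esub> v\<close> is symmetric.
  The null graph is allowed.
\<close>

definition clique_in :: "('a, 'b) pre_digraph \<Rightarrow> 'a set \<Rightarrow> bool" where
  "clique_in G K \<longleftrightarrow> K \<subseteq> verts G \<and> (\<forall>u\<in>K. \<forall>v\<in>K. u \<noteq> v \<longrightarrow> u \<rightarrow>\<^bsub>G\<^esub> v)"

definition independent_in :: "('a, 'b) pre_digraph \<Rightarrow> 'a set \<Rightarrow> bool" where
  "independent_in G S \<longleftrightarrow> S \<subseteq> verts G \<and> (\<forall>u\<in>S. \<forall>v\<in>S. \<not> u \<rightarrow>\<^bsub>G\<^esub> v)"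

definition clique_number :: "('a, 'b) pre_digraph \<Rightarrow> nat" where
  "clique_number G = Max {card K | K. clique_in G K}"

definition independence_number :: "('a, 'b) pre_digraph \<Rightarrow> nat" where
  "independence_number G = Max {card S | S. independent_in G S}"

definition proper_colouring :: "('a, 'b) pre_digraph \<Rightarrow> nat \<Rightarrow> ('a \<Rightarrow> nat) \<Rightarrow> bool" where
  "proper_colouring G n c \<longleftrightarrow>
     (\<forall>v\<in>verts G. c v < n) \<and> (\<forall>u v. u \<rightarrow>\<^bsub>G\<^esub> v \<longrightarrow> c u \<noteq> c v)"

definition chromatic_number :: "('a, 'b) pre_digraph \<Rightarrow> nat" where
  "chromatic_number G = (LEAST n. \<exists>c. proper_colouring G n c)"

text \<open>
  The library's \<^const>\<open>Digraph_Component.tree\<close> is not usable for symmetric digraphs: there the walk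
  \<open>u, v, u\<close> along a single edge counts as a cycle.  The cycles of the underlying
  undirected simple graph are exactly those of length at least 3.  As
  \<^const>\<open>Digraph_Component.connected\<close> demands a vertex, trees are nonempty.
\<close>

definition undirected_tree :: "('a, 'b) pre_digraph \<Rightarrow> bool" where
  "undirected_tree T \<longleftrightarrow> Digraph.graph T \<and> Digraph_Component.connected T \<and>
     \<not> (\<exists>p. pre_digraph.cycle T p \<and> 3 \<le> length p)"

definition tree_decomposition ::
    "('a, 'b) pre_digraph \<Rightarrow> ('t, 's) pre_digraph \<Rightarrow> ('t \<Rightarrow> 'a set) \<Rightarrow> bool" where
  "tree_decomposition G T X \<longleftrightarrow> undirected_tree T \<and>
     (\<forall>t\<in>verts T. X t \<subseteq> verts G) \<and>
     (\<forall>v\<in>verts G. \<exists>t\<in>verts T. v \<in> X t) \<and>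
     (\<forall>u v. u \<rightarrow>\<^bsub>G\<^esub> v \<longrightarrow> (\<exists>t\<in>verts T. u \<in> X t \<and> v \<in> X t)) \<and>
     (\<forall>v\<in>verts G. Digraph_Component.connected (T \<restriction> {t \<in> verts T. v \<in> X t}))"

definition decomposition_alpha ::
    "('a, 'b) pre_digraph \<Rightarrow> ('t, 's) pre_digraph \<Rightarrow> ('t \<Rightarrow> 'a set) \<Rightarrow> nat" where
  "decomposition_alpha G T X = Max ((\<lambda>t. independence_number (G \<restriction> X t)) ` verts T)"

text \<open>
  Nodes of the decomposition tree are natural numbers; since trees are finite, this covers
  every tree decomposition up to renaming of the nodes.  The infimum is attained, see
  \<open>tree_alpha_attained\<close> below.
\<close>

definition tree_alpha :: "('a, 'b) pre_digraph \<Rightarrow> nat" where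
  "tree_alpha G = Inf {decomposition_alpha G T X |
     (T :: (nat, nat \<times> nat) pre_digraph) X. tree_decomposition G T X}"

definition single_node :: "(nat, nat \<times> nat) pre_digraph" where
  "single_node = \<lparr>verts = {0}, arcs = {}, tail = fst, head = snd\<rparr>"

lemma connected_single_vertex:
  assumes "verts G = {v}" and "arcs G = {}"
  shows "Digraph_Component.connected G"
  using assms
  by (simp add: Digraph_Component.connected_def strongly_connected_def mk_symmetric_def
      reachable_def)

lemma undirected_tree_single_node: "undirected_tree single_node"
proof -
  have "Digraph.graph single_node"
    by unfold_locales (auto simp: single_node_def symmetric_def arcs_ends_def sym_def)
  moreover have "Digraph_Component.connected single_node"
    by (rule connected_single_vertex[of _ 0]) (auto simp: single_node_def)
  moreover have "\<not> pre_digraph.cycle single_node p" for p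
    by (cases p) (auto simp: pre_digraph.cycle_def pre_digraph.awalk_def single_node_def)
  ultimately show ?thesis
    by (auto simp: undirected_tree_def)
qed

lemma tree_decomposition_single_bag:
  assumes "wf_digraph G"
  shows "tree_decomposition G single_node (\<lambda>_. verts G)"
proof -
  interpret wf_digraph G by fact
  have "Digraph_Component.connected (single_node \<restriction> {t \<in> verts single_node. v \<in> verts G})"
    if "v \<in> verts G" for v
    by (rule connected_single_vertex[of _ 0]) (use that in \<open>auto simp: single_node_def\<close>)
  then show ?thesis
    using undirected_tree_single_node
    by (auto simp: tree_decomposition_def single_node_def arcs_ends_conv)
qed

lemma tree_alpha_attained:
  assumes "wf_digraph G"
  obtains T :: "(nat, nat \<times> nat) pre_digraph" and X
  where "tree_decomposition G T X" and "decomposition_alpha G T X = tree_alpha G"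
proof -
  let ?A = "{decomposition_alpha G T X |
     (T :: (nat, nat \<times> nat) pre_digraph) X. tree_decomposition G T X}"
  have "?A \<noteq> {}"
    using tree_decomposition_single_bag[OF assms] by blast
  then have "Inf ?A \<in> ?A"
    by (rule Inf_nat_def1)
  then show ?thesis
    using that unfolding tree_alpha_def by force
qed

end

theory Submission
  imports Defs
begin

text \<open>
  If every bag of a tree decomposition has independence number at most \<open>k\<close>, then in a subgraph with
  clique number \<open>\<omega>\<close> a Ramsey argument bounds the bags by \<open>(\<omega> + 1)^k - 1\<close> vertices.  Root the
  decomposition tree and take, in any nonempty vertex set, the vertex \<open>v\<close> whose subtree starts
  farthest from the root: the node of its subtree closest to the root has a bag containing all neighbours of \<open>v\<close>
  in the set.  So the graph is degenerate and greedy colouring needs at most \<open>(\<omega> + 1)^k\<close> colours.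
\<close>

section \<open>Ramsey bound and greedy colouring\<close>

lemma finite_clique_cards:
  assumes "finite (verts G)"
  shows "finite {card K | K. clique_in G K}"
  by (rule finite_subset[of _ "card ` Pow (verts G)"]) (use assms in \<open>auto simp: clique_in_def\<close>)

lemma finite_independent_cards:
  assumes "finite (verts G)"
  shows "finite {card S | S. independent_in G S}"
  by (rule finite_subset[of _ "card ` Pow (verts G)"]) (use assms in \<open>auto simp: independent_in_def\<close>)

lemma card_clique_le_clique_number:
  assumes "finite (verts G)" and "clique_in G K"
  shows "card K \<le> clique_number G"
  unfolding clique_number_def
  by (rule Max_ge[OF finite_clique_cards[OF assms(1)]]) (use assms(2) in blast)

lemma card_independent_le_independence_number:
  assumes "finite (verts G)" and "independent_in G S"
  shows "card S \<le> independence_number G"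
  unfolding independence_number_def
  by (rule Max_ge[OF finite_independent_cards[OF assms(1)]]) (use assms(2) in blast)

text \<open>
  A maximal clique has at most \<open>w\<close> vertices, and every vertex outside it misses one of them;
  the non-neighbours of a fixed vertex have smaller independence number.
\<close>

lemma card_less_of_clique_independent_bounds:
  fixes E :: "('a \<times> 'a) set"
  assumes "sym E" and "finite V" and "\<And>v. v \<in> V \<Longrightarrow> (v, v) \<notin> E"
    and "\<And>K. K \<subseteq> V \<Longrightarrow> (\<forall>u\<in>K. \<forall>v\<in>K. u \<noteq> v \<longrightarrow> (u, v) \<in> E) \<Longrightarrow> card K \<le> w"
    and "\<And>S. S \<subseteq> V \<Longrightarrow> (\<forall>u\<in>S. \<forall>v\<in>S. (u, v) \<notin> E) \<Longrightarrow> card S \<le> k"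
  shows "card V < (w + 1) ^ k"
  using assms(2-)
proof (induction k arbitrary: V)
  case 0
  \<comment> \<open>Without loops a single vertex is already an independent set of size 1.\<close>
  have "V = {}"
  proof (rule ccontr)
    assume "V \<noteq> {}"
    then obtain v where "v \<in> V" by blast
    with 0(2) 0(4)[of "{v}"] show False by auto
  qed
  then show ?case by simp
next
  case (Suc k)
  define C where "C = {K. K \<subseteq> V \<and> (\<forall>u\<in>K. \<forall>v\<in>K. u \<noteq> v \<longrightarrow> (u, v) \<in> E)}"
  have "finite C" "{} \<in> C"
    using Suc.prems(1) by (auto simp: C_def)
  then obtain K where K: "K \<in> C" and max: "\<And>L. L \<in> C \<Longrightarrow> K \<subseteq> L \<Longrightarrow> L = K"
    using finite_has_maximal[of C] by (metis empty_iff)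
  have KV: "K \<subseteq> V" and cliq: "\<And>u v. u \<in> K \<Longrightarrow> v \<in> K \<Longrightarrow> u \<noteq> v \<Longrightarrow> (u, v) \<in> E"
    using K by (auto simp: C_def)
  have cK: "card K \<le> w"
    using Suc.prems(3) KV cliq by blast
  have finK: "finite K"
    using KV Suc.prems(1) finite_subset by blast
  \<comment> \<open>Absence of loops would put \<open>v\<close> among its own non-neighbours; it is
    excluded so that adding \<open>v\<close> to an independent subset of \<open>N v\<close> enlarges
    it.\<close>
  define N where "N v = {x \<in> V. x \<noteq> v \<and> (x, v) \<notin> E}" for v
  have cover: "V \<subseteq> K \<union> (\<Union>v\<in>K. N v)"
  proof
    fix x assume x: "x \<in> V"
    show "x \<in> K \<union> (\<Union>v\<in>K. N v)"
    proof (rule ccontr)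
      assume "x \<notin> K \<union> (\<Union>v\<in>K. N v)"
      then have "x \<notin> K" "\<And>v. v \<in> K \<Longrightarrow> (x, v) \<in> E"
        using x by (auto simp: N_def)
      then have "insert x K \<in> C"
        using x KV cliq symD[OF \<open>sym E\<close>] by (auto simp: C_def)
      then show False
        using max[of "insert x K"] \<open>x \<notin> K\<close> by blast
    qed
  qed
  \<comment> \<open>The strict bound leaves room for one more vertex. Charging each clique vertex
    \<open>v\<close> to its own \<open>N v\<close> is what keeps the final sum at
    \<open>w * (w + 1) ^ k\<close>.\<close>
  have cN: "Suc (card (N v)) \<le> (w + 1) ^ k" if "v \<in> K" for v
  proof (rule Suc_leI, rule Suc.IH)
    show "finite (N v)"
      using Suc.prems(1) by (simp add: N_def)
    show "(x, x) \<notin> E" if "x \<in> N v" for x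
      using that Suc.prems(2) by (simp add: N_def)
    show "card L \<le> w" if "L \<subseteq> N v" "\<forall>x\<in>L. \<forall>y\<in>L. x \<noteq> y \<longrightarrow> (x, y) \<in> E" for L
      using that by (intro Suc.prems(3)) (auto simp: N_def)
    show "card S \<le> k" if S: "S \<subseteq> N v" "\<forall>x\<in>S. \<forall>y\<in>S. (x, y) \<notin> E" for S
    proof -
      have "card (insert v S) \<le> Suc k"
      proof (rule Suc.prems(4))
        show "insert v S \<subseteq> V"
          using S(1) \<open>v \<in> K\<close> KV by (auto simp: N_def)
        show "\<forall>x\<in>insert v S. \<forall>y\<in>insert v S. (x, y) \<notin> E"
          using S \<open>v \<in> K\<close> KV Suc.prems(2) \<open>sym E\<close> by (auto simp: N_def dest: symD)
      qed
      moreover have "v \<notin> S" "finite S"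
        using S(1) Suc.prems(1) finite_subset[of S V] by (auto simp: N_def)
      ultimately show ?thesis by simp
    qed
  qed
  have "card V \<le> card (K \<union> (\<Union>v\<in>K. N v))"
    by (rule card_mono[OF _ cover]) (use finK Suc.prems(1) in \<open>auto simp: N_def\<close>)
  also have "\<dots> \<le> card K + (\<Sum>v\<in>K. card (N v))"
    using card_Un_le[of K "\<Union>v\<in>K. N v"] card_UN_le[OF finK, of N] by linarith
  also have "\<dots> = (\<Sum>v\<in>K. Suc (card (N v)))"
    by (simp add: sum_Suc)
  also have "\<dots> \<le> card K * (w + 1) ^ k"
    using sum_mono[of K "\<lambda>v. Suc (card (N v))" "\<lambda>_. (w + 1) ^ k"] cN by simp
  also have "\<dots> \<le> w * (w + 1) ^ k"
    using cK by simp
  also have "\<dots> < (w + 1) ^ Suc k"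
    by simp
  finally show ?case .
qed

text \<open>Greedy colouring: delete a vertex with fewer than \<open>m\<close> neighbours, colour
  the rest by induction, and give the deleted vertex a colour missing from its
  neighbourhood.\<close>

lemma degenerate_colouring:
  fixes E :: "('a \<times> 'a) set" and m :: nat
  assumes "sym E" and "irrefl E" and "finite V"
    and "\<And>S. S \<subseteq> V \<Longrightarrow> S \<noteq> {} \<Longrightarrow> \<exists>v\<in>S. card {u \<in> S. (v, u) \<in> E} < m"
  shows "\<exists>c. (\<forall>v\<in>V. c v < m) \<and> (\<forall>u\<in>V. \<forall>v\<in>V. (u, v) \<in> E \<longrightarrow> c u \<noteq> c v)"
  using assms(3,4)
proof (induction V rule: finite_psubset_induct)
  case (psubset V)
  show ?case
  proof (cases "V = {}")
    case False
    then obtain v where v: "v \<in> V" "card {u \<in> V. (v, u) \<in> E} < m"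
      using psubset.prems[of V] by blast
    have "\<exists>c. (\<forall>x\<in>V - {v}. c x < m) \<and> (\<forall>x\<in>V - {v}. \<forall>y\<in>V - {v}. (x, y) \<in> E \<longrightarrow> c x \<noteq> c y)"
      by (rule psubset.IH) (use v psubset.prems in auto)
    then obtain c where c: "\<And>x. x \<in> V - {v} \<Longrightarrow> c x < m"
      "\<And>x y. x \<in> V - {v} \<Longrightarrow> y \<in> V - {v} \<Longrightarrow> (x, y) \<in> E \<Longrightarrow> c x \<noteq> c y"
      by blast
    have "finite {u \<in> V. (v, u) \<in> E}"
      using psubset.hyps by simp
    then have "card (c ` {u \<in> V. (v, u) \<in> E}) < card {..<m}"
      using v(2) card_image_le[of "{u \<in> V. (v, u) \<in> E}" c] by simp
    then obtain i where i: "i < m" "i \<notin> c ` {u \<in> V. (v, u) \<in> E}"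
      using card_mono[of "c ` {u \<in> V. (v, u) \<in> E}" "{..<m}"] psubset.hyps
      by (metis (no_types, lifting) \<open>finite {u \<in> V. (v, u) \<in> E}\<close> finite_imageI lessThan_iff
          linorder_not_less subsetI)
    have "(v, v) \<notin> E"
      using \<open>irrefl E\<close> by (simp add: irrefl_def)
    then have "(\<forall>x\<in>V. (c(v := i)) x < m) \<and>
        (\<forall>x\<in>V. \<forall>y\<in>V. (x, y) \<in> E \<longrightarrow> (c(v := i)) x \<noteq> (c(v := i)) y)"
      using c i \<open>sym E\<close> by (auto dest: symD)
    then show ?thesis by blast
  qed simp
qed

section \<open>Subtrees of the decomposition tree\<close>

text \<open>Cut the path at its last visit to \<open>a\<close>; \<open>c\<close> is the node right
  after it.\<close>

lemma rtrancl_avoiding_start: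
  assumes "(a, b) \<in> R\<^sup>*" and "b \<noteq> a"
  obtains c where "(a, c) \<in> R" and "(c, b) \<in> (R \<inter> (- {a}) \<times> (- {a}))\<^sup>*"
proof -
  have "b = a \<or> (\<exists>c. (a, c) \<in> R \<and> (c, b) \<in> (R \<inter> (- {a}) \<times> (- {a}))\<^sup>*)"
    using assms(1)
  proof induction
    case (step b d)
    show ?case
    \<comment> \<open>A new arc into \<open>a\<close> gives the first disjunct; an arc out of
      \<open>a\<close> restarts the tail with \<open>c = d\<close>.\<close>
    proof (cases "d = a \<or> b = a")
      case True
      then show ?thesis using step.hyps(2) by auto
    next
      case False
      then obtain c where "(a, c) \<in> R" "(c, b) \<in> (R \<inter> (- {a}) \<times> (- {a}))\<^sup>*"
        using step.IH by blast
      moreover have "(b, d) \<in> R \<inter> (- {a}) \<times> (- {a})"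
        using False step.hyps(2) by simp
      ultimately show ?thesis
        by (meson rtrancl.rtrancl_into_rtrancl)
    qed
  qed simp
  then show thesis using assms(2) that by blast
qed

text \<open>A path from \<open>p\<close> to \<open>q\<close> off \<open>a\<close> would close up
  through \<open>a\<close> to an undirected cycle.\<close>

lemma undirected_tree_neighbours_separated:
  assumes T: "undirected_tree T" and p: "a \<rightarrow>\<^bsub>T\<^esub> p" and q: "a \<rightarrow>\<^bsub>T\<^esub> q" and "p \<noteq> q"
  shows "(p, q) \<notin> (arcs_ends T \<inter> (- {a}) \<times> (- {a}))\<^sup>*"
proof
  assume pq: "(p, q) \<in> (arcs_ends T \<inter> (- {a}) \<times> (- {a}))\<^sup>*"
  interpret T: Digraph.graph T using T by (simp add: undirected_tree_def)
  define H where "H = T \<restriction> (verts T - {a})"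
  interpret H: wf_digraph H
    unfolding H_def by (rule T.wellformed_induce_subgraph)
  have sub: "subgraph H T"
    unfolding H_def by (rule induced_imp_subgraph, rule T.induced_induce) auto
  have "p \<in> verts H"
    using p T.adj_not_same by (auto simp: H_def)
  have "p \<rightarrow>\<^sup>*\<^bsub>H\<^esub> q"
    using pq
  proof induction
    case base
    then show ?case using \<open>p \<in> verts H\<close> by simp
  next
    case (step y z)
    then have "y \<rightarrow>\<^bsub>H\<^esub> z"
      by (auto simp: H_def arcs_ends_conv intro!: image_eqI)
    with step.IH show ?case by (rule H.reachable_adj_trans)
  qed
  \<comment> \<open>A simple path has distinct vertices, as a cycle requires; staying inside
    \<open>H\<close> keeps \<open>a\<close> off it.\<close>
  then obtain w where w: "H.apath p w q"
    using H.reachable_apath by blast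
  have wT: "T.awalk p w q" and verts_eq: "H.awalk_verts p w = T.awalk_verts p w"
    using w sub T.subgraph_awalk_imp_awalk compatible_awalk_verts[of H T]
    by (auto simp: H.apath_def subgraph_def compatible_def pre_digraph.awalk_verts_conv)
  have notin: "a \<notin> set (T.awalk_verts p w)" and dist: "distinct (T.awalk_verts p w)"
    using w verts_eq by (auto simp: H.apath_def H.awalk_conv) (auto simp: H_def)
  have "w \<noteq> []"
    using w \<open>p \<noteq> q\<close> by (auto simp: H.apath_def H.awalk_def)
  obtain e where e: "e \<in> arcs T" "tail T e = a" "head T e = p"
    using p by auto
  have "q \<rightarrow>\<^bsub>T\<^esub> a"
    using q T.sym_arcs by (simp add: symmetric_def symD)
  then obtain f where f: "f \<in> arcs T" "tail T f = q" "head T f = a"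
    by auto
  have tail: "T.awalk q [f] a"
    using f by (auto simp: T.awalk_def)
  then have wf: "T.awalk p (w @ [f]) a"
    using wT by (rule_tac T.awalk_appendI)
  then have "T.awalk a (e # w @ [f]) a"
    using e by (auto simp: T.awalk_Cons_iff)
  moreover have "T.awalk_verts p (w @ [f]) = T.awalk_verts p w @ [a]"
    using wT \<open>w \<noteq> []\<close> f tail
    by (subst T.awalk_verts_append[OF wf]) (auto dest: T.awlast_if_cas simp: T.awalk_def)
  ultimately have "T.cycle (e # w @ [f])"
    unfolding T.cycle_def using e notin dist by (intro exI[of _ a]) auto
  \<comment> \<open>The arcs \<open>e\<close> and \<open>f\<close> at \<open>a\<close>, and at least
    one arc in \<open>w\<close> because p and q differ: the cycle is not a walk back and forth along
    one edge.\<close>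
  moreover have "3 \<le> length (e # w @ [f])"
    using \<open>w \<noteq> []\<close> by (cases w) auto
  ultimately show False
    using T by (auto simp: undirected_tree_def)
qed

text \<open>Connectedness is stated for the symmetric closure, which adds no adjacencies to a
  symmetric digraph.\<close>

lemma connected_induce_rtrancl:
  assumes "Digraph.graph T" and "Digraph_Component.connected (T \<restriction> A)"
    and "A \<subseteq> verts T" and "x \<in> A" and "y \<in> A"
  shows "(x, y) \<in> (arcs_ends T \<inter> A \<times> A)\<^sup>*"
proof -
  interpret T: Digraph.graph T by fact
  have "(x, y) \<in> rtrancl_on A (parcs (mk_symmetric (T \<restriction> A)))"
    using assms(2,4,5)
    by (auto simp: Digraph_Component.connected_def strongly_connected_def reachable_def)
  moreover have "parcs (mk_symmetric (T \<restriction> A)) \<subseteq> arcs_ends T \<inter> A \<times> A"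
    using T.sym_arcs by (auto simp: parcs_mk_symmetric arcs_ends_conv symmetric_def sym_def)
  ultimately show ?thesis
    by (metis rtrancl_mono rtrancl_on_rtranclI subsetD)
qed

text \<open>Graph distance from the root \<open>r\<close>; meaningful only for nodes reachable from
  \<open>r\<close>, where the least \<open>n\<close> exists.\<close>

definition root_distance :: "('t \<times> 't) set \<Rightarrow> 't \<Rightarrow> 't \<Rightarrow> nat" where
  "root_distance E r x = (LEAST n. (r, x) \<in> E ^^ n)"

lemma root_distance_refl [simp]: "root_distance E r r = 0"
  unfolding root_distance_def by (rule Least_eq_0) simp

text \<open>Take the node before last on a shortest walk from \<open>r\<close> to
  \<open>x\<close>.\<close>

lemma root_distance_predecessor:
  assumes "(r, x) \<in> E\<^sup>*" and "x \<noteq> r"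
  obtains p where "(p, x) \<in> E" and "(r, p) \<in> E\<^sup>*" and "root_distance E r p < root_distance E r x"
proof -
  have x: "(r, x) \<in> E ^^ root_distance E r x"
    using rtrancl_imp_relpow[OF assms(1)] unfolding root_distance_def by (rule LeastI_ex)
  then obtain n where n: "root_distance E r x = Suc n"
    using assms(2) by (cases "root_distance E r x") auto
  then obtain p where p: "(r, p) \<in> E ^^ n" "(p, x) \<in> E"
    using x by auto
  have "root_distance E r p \<le> n"
    unfolding root_distance_def using p(1) by (rule Least_le)
  then show thesis
    using that p n relpow_imp_rtrancl by fastforce
qed

text \<open>All earlier nodes on a shortest walk to \<open>x\<close> are strictly closer to
  \<open>r\<close> than \<open>x\<close>, hence than \<open>a\<close>, so none of them is
  \<open>a\<close>.\<close>

lemma rtrancl_avoiding_far_node: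
  assumes "(r, x) \<in> E\<^sup>*" and "root_distance E r x \<le> root_distance E r a" and "x \<noteq> a"
  shows "(r, x) \<in> (E \<inter> (- {a}) \<times> (- {a}))\<^sup>*"
  using assms
proof (induction "root_distance E r x" arbitrary: x rule: less_induct)
  case less
  show ?case
  proof (cases "x = r")
    case False
    then obtain p where p: "(p, x) \<in> E" "(r, p) \<in> E\<^sup>*" "root_distance E r p < root_distance E r x"
      using root_distance_predecessor less.prems(1) by metis
    then have "p \<noteq> a"
      using less.prems(2) by auto
    then have "(r, p) \<in> (E \<inter> (- {a}) \<times> (- {a}))\<^sup>*"
      using less.hyps p less.prems(2) by simp
    moreover have "(p, x) \<in> E \<inter> (- {a}) \<times> (- {a})"
      using p(1) \<open>p \<noteq> a\<close> less.prems(3) by simp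
    ultimately show ?thesis
      by (rule rtrancl_into_rtrancl)
  qed simp
qed

text \<open>
  If \<open>a\<close> were not in \<open>B\<close>, its predecessor towards the root and a neighbour of \<open>a\<close> inside \<open>A\<close> would be
  joined by a path avoiding \<open>a\<close>: through \<open>A\<close> and \<open>B\<close> to \<open>b\<close>, and on through the root.
\<close>

lemma closest_node_mem_subtree:
  assumes T: "undirected_tree T" and r: "r \<in> verts T"
    and A: "A \<subseteq> verts T" "Digraph_Component.connected (T \<restriction> A)"
    and B: "B \<subseteq> verts T" "Digraph_Component.connected (T \<restriction> B)"
    and c: "c \<in> A" "c \<in> B" and a: "a \<in> A" and b: "b \<in> B"
    and min: "\<And>x. x \<in> A \<Longrightarrow> root_distance (arcs_ends T) r a \<le> root_distance (arcs_ends T) r x"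
    and le: "root_distance (arcs_ends T) r b \<le> root_distance (arcs_ends T) r a"
  shows "a \<in> B"
proof (rule ccontr)
  assume "a \<notin> B"
  interpret T: Digraph.graph T using T by (simp add: undirected_tree_def)
  let ?E = "arcs_ends T"
  let ?R = "?E \<inter> (- {a}) \<times> (- {a})"
  have graph: "Digraph.graph T" by unfold_locales
  have symE: "sym ?E" using T.sym_arcs by (simp add: symmetric_def)
  then have symR: "sym (?R\<^sup>*)"
    by (intro sym_rtrancl) (auto simp: sym_def)
  \<comment> \<open>This lets the lemma on connected node sets apply to the whole tree.\<close>
  have "T \<restriction> verts T = T"
    using T.wellformed by (cases T) (auto simp: induce_subgraph_def)
  then have "Digraph_Component.connected (T \<restriction> verts T)"
    using T by (simp add: undirected_tree_def)
  from connected_induce_rtrancl[OF graph this _ r] have root: "(r, x) \<in> ?E\<^sup>*" if "x \<in> verts T" for x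
    using that rtrancl_mono[of "?E \<inter> verts T \<times> verts T" ?E] by blast
  have "(r, b) \<in> ?R\<^sup>*"
    using root b B(1) le \<open>a \<notin> B\<close> by (intro rtrancl_avoiding_far_node) auto
  moreover have "(b, c) \<in> ?R\<^sup>*"
    using connected_induce_rtrancl[OF graph B(2,1) b c(2)] \<open>a \<notin> B\<close>
      rtrancl_mono[of "?E \<inter> B \<times> B" ?R] by blast
  ultimately have rc: "(r, c) \<in> ?R\<^sup>*"
    by (rule rtrancl_trans)
  have "c \<noteq> a" using c(2) \<open>a \<notin> B\<close> by blast
  \<comment> \<open>\<open>d\<close> is the neighbour of \<open>a\<close> through which a path
    inside \<open>A\<close> finally leaves \<open>a\<close> towards \<open>c\<close>.\<close>
  with connected_induce_rtrancl[OF graph A(2,1) a c(1)]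
  obtain d where d: "(a, d) \<in> ?E \<inter> A \<times> A"
      and "(d, c) \<in> (?E \<inter> A \<times> A \<inter> (- {a}) \<times> (- {a}))\<^sup>*"
    by (rule rtrancl_avoiding_start)
  then have dc: "(d, c) \<in> ?R\<^sup>*"
    using rtrancl_mono[of "?E \<inter> A \<times> A \<inter> (- {a}) \<times> (- {a})" ?R] by blast
  \<comment> \<open>Needed for \<open>a\<close> to have a predecessor. If \<open>a\<close> were the
    root, \<open>b\<close> would have distance 0 and so equal \<open>a\<close>, putting
    \<open>a\<close> in \<open>B\<close>.\<close>
  have "a \<noteq> r"
  proof
    assume "a = r"
    then have "root_distance ?E r b = 0" using le by simp
    then have "b = r"
      using root_distance_predecessor[of r b ?E] root b B(1) by (metis not_less0 subsetD)
    then show False using \<open>a = r\<close> b \<open>a \<notin> B\<close> by simp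
  qed
  then obtain p where p: "(p, a) \<in> ?E" "(r, p) \<in> ?E\<^sup>*" "root_distance ?E r p < root_distance ?E r a"
    using root_distance_predecessor root a A(1) by (metis subsetD)
  \<comment> \<open>\<open>p\<close> is closer to the root than \<open>a\<close>, the closest node
    of \<open>A\<close>; hence \<open>p\<close> differs from \<open>d\<close>, which lies in
    \<open>A\<close>.\<close>
  then have "p \<notin> A" using min by fastforce
  have "(r, p) \<in> ?R\<^sup>*"
    using p a \<open>p \<notin> A\<close> by (intro rtrancl_avoiding_far_node) auto
  then have "(d, p) \<in> ?R\<^sup>*"
    using dc rc symR by (meson rtrancl_trans symD)
  moreover have "d \<noteq> p" using d \<open>p \<notin> A\<close> by blast
  ultimately show False
    using undirected_tree_neighbours_separated[OF T, of a d p] d symD[OF symE p(1)] by blast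
qed

text \<open>In the chordal graph joining any two vertices that share a bag, this \<open>v\<close> is
  simplicial within \<open>S\<close>. The subtree of a neighbour \<open>u\<close> meets that of
  \<open>v\<close> and starts no farther from the root, so it contains the top node of
  \<open>v\<close>.\<close>

lemma tree_decomposition_simplicial_bag:
  assumes G: "Digraph.graph G" and dec: "tree_decomposition G T X"
    and S: "S \<subseteq> verts G" "S \<noteq> {}"
  obtains v t where "v \<in> S" and "t \<in> verts T" and "v \<in> X t"
    and "\<And>u. u \<in> S \<Longrightarrow> v \<rightarrow>\<^bsub>G\<^esub> u \<Longrightarrow> u \<in> X t"
proof -
  interpret G: Digraph.graph G by fact
  have T: "undirected_tree T" using dec by (simp add: tree_decomposition_def)
  then obtain r where r: "r \<in> verts T"
    by (auto simp: undirected_tree_def Digraph_Component.connected_def strongly_connected_def)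
  define h where "h = root_distance (arcs_ends T) r"
  define A where "A v = {t \<in> verts T. v \<in> X t}" for v
  define top where "top v = (ARG_MIN h t. t \<in> A v)" for v
  have A: "A v \<subseteq> verts T" "Digraph_Component.connected (T \<restriction> A v)" if "v \<in> S" for v
    using dec S(1) that by (auto simp: A_def tree_decomposition_def)
  have top: "top v \<in> A v" "\<And>x. x \<in> A v \<Longrightarrow> h (top v) \<le> h x" if "v \<in> S" for v
  proof -
    have "v \<in> verts G" using S(1) that by blast
    then obtain t where "t \<in> A v"
      using dec by (auto simp: A_def tree_decomposition_def)
    from arg_min_nat_lemma[of "\<lambda>t. t \<in> A v", OF this]
    show "top v \<in> A v" "\<And>x. x \<in> A v \<Longrightarrow> h (top v) \<le> h x"
      by (auto simp: top_def)
  qed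
  have fin: "finite S" using finite_subset[OF S(1) G.finite_verts] .
  \<comment> \<open>Some vertex of \<open>S\<close> has its top node at maximal distance from the
    root; it serves as \<open>v\<close>.\<close>
  then have "Max ((\<lambda>v. h (top v)) ` S) \<in> (\<lambda>v. h (top v)) ` S"
    using S(2) by simp
  then obtain v where v: "v \<in> S" and eq: "Max ((\<lambda>v. h (top v)) ` S) = h (top v)"
    by blast
  have max: "h (top u) \<le> h (top v)" if "u \<in> S" for u
    using fin that eq[symmetric] by simp
  show thesis
  proof (rule that[OF v])
    show "top v \<in> verts T" "v \<in> X (top v)"
      using top[OF v] by (auto simp: A_def)
    fix u assume u: "u \<in> S" "v \<rightarrow>\<^bsub>G\<^esub> u"
    from dec have "\<forall>u v. u \<rightarrow>\<^bsub>G\<^esub> v \<longrightarrow> (\<exists>t\<in>verts T. u \<in> X t \<and> v \<in> X t)"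
      by (simp add: tree_decomposition_def)
    with u(2) obtain c where "c \<in> A v" "c \<in> A u"
      unfolding A_def by blast
    then have "top v \<in> A u"
      using closest_node_mem_subtree[OF T r A[OF v] A[OF u(1)]] top[OF v] top[OF u(1)] max[OF u(1)]
      unfolding h_def by blast
    then show "u \<in> X (top v)" by (simp add: A_def)
  qed
qed

section \<open>Polynomial \<open>\<chi>\<close>-boundedness\<close>

lemma dominates_induced_subgraph_iff:
  assumes "induced_subgraph H G"
  shows "u \<rightarrow>\<^bsub>H\<^esub> v \<longleftrightarrow> u \<in> verts H \<and> v \<in> verts H \<and> u \<rightarrow>\<^bsub>G\<^esub> v"
proof -
  have *: "arcs H = {e \<in> arcs G. tail G e \<in> verts H \<and> head G e \<in> verts H}"
    "tail H = tail G" "head H = head G"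
    using assms by (auto simp: induced_subgraph_def subgraph_def compatible_def)
  show ?thesis
    unfolding arcs_ends_conv * by auto
qed

lemma tree_decomposition_card_independent_le:
  assumes "Digraph.graph G" and "tree_decomposition G T X" and "t \<in> verts T"
    and "S \<subseteq> X t" and "\<And>u v. u \<in> S \<Longrightarrow> v \<in> S \<Longrightarrow> \<not> u \<rightarrow>\<^bsub>G\<^esub> v"
  shows "card S \<le> decomposition_alpha G T X"
proof -
  interpret G: Digraph.graph G by fact
  interpret T: Digraph.graph T
    using assms(2) by (simp add: tree_decomposition_def undirected_tree_def)
  have "X t \<subseteq> verts G"
    using assms(2,3) by (simp add: tree_decomposition_def)
  then have "finite (verts (G \<restriction> X t))"
    using finite_subset[OF _ G.finite_verts] by simp
  moreover have "independent_in (G \<restriction> X t) S"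
    using assms(4,5) by (auto simp: independent_in_def dest: dominates_induce_subgraphD)
  ultimately have "card S \<le> independence_number (G \<restriction> X t)"
    by (rule card_independent_le_independence_number)
  also have "\<dots> \<le> decomposition_alpha G T X"
    unfolding decomposition_alpha_def by (rule Max_ge) (use assms(3) in auto)
  finally show ?thesis .
qed

lemma chromatic_number_induced_le:
  assumes G: "Digraph.graph G" and H: "induced_subgraph H G"
  shows "chromatic_number H \<le> (clique_number H + 1) ^ tree_alpha G"
proof -
  interpret G: Digraph.graph G by fact
  obtain T :: "(nat, nat \<times> nat) pre_digraph" and X
    where dec: "tree_decomposition G T X" and alpha: "decomposition_alpha G T X = tree_alpha G"
    using tree_alpha_attained[OF G.wf_digraph_axioms] .
  let ?w = "clique_number H" and ?k = "tree_alpha G"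
  have VH: "verts H \<subseteq> verts G"
    using H by (auto simp: induced_subgraph_def subgraph_def)
  then have finH: "finite (verts H)"
    using finite_subset[OF _ G.finite_verts] by simp
  have symE: "sym (arcs_ends G)"
    using G.sym_arcs by (simp add: symmetric_def)
  have irr: "(v, v) \<notin> arcs_ends G" for v
    using G.adj_not_same by blast
  \<comment> \<open>The decomposition of \<open>G\<close> is used directly for \<open>H\<close>: as
    \<open>H\<close> is induced, a clique of \<open>G\<close> inside \<open>H\<close> is a clique of
    \<open>H\<close>, while independent sets are bounded through the bag of
    \<open>G\<close>.\<close>
  have bag: "card (X t \<inter> verts H) < (?w + 1) ^ ?k" if t: "t \<in> verts T" for t
  proof (rule card_less_of_clique_independent_bounds[OF symE])
    show "finite (X t \<inter> verts H)" using finH by simp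
    show "card K \<le> ?w"
      if "K \<subseteq> X t \<inter> verts H" "\<forall>u\<in>K. \<forall>v\<in>K. u \<noteq> v \<longrightarrow> u \<rightarrow>\<^bsub>G\<^esub> v" for K
      by (rule card_clique_le_clique_number[OF finH])
        (use that in \<open>auto simp: clique_in_def dominates_induced_subgraph_iff[OF H]\<close>)
    show "card S \<le> ?k" if "S \<subseteq> X t \<inter> verts H" "\<forall>u\<in>S. \<forall>v\<in>S. \<not> u \<rightarrow>\<^bsub>G\<^esub> v" for S
      using tree_decomposition_card_independent_le[OF G dec t, of S] that alpha by auto
  qed (rule irr)
  have "\<exists>c. (\<forall>v\<in>verts H. c v < (?w + 1) ^ ?k) \<and>
      (\<forall>u\<in>verts H. \<forall>v\<in>verts H. u \<rightarrow>\<^bsub>G\<^esub> v \<longrightarrow> c u \<noteq> c v)"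
  proof (rule degenerate_colouring[OF symE _ finH])
    show "irrefl (arcs_ends G)" using irr by (simp add: irrefl_def)
    fix S assume S: "S \<subseteq> verts H" "S \<noteq> {}"
    then obtain v t where v: "v \<in> S" "t \<in> verts T" "\<And>u. u \<in> S \<Longrightarrow> v \<rightarrow>\<^bsub>G\<^esub> u \<Longrightarrow> u \<in> X t"
      using tree_decomposition_simplicial_bag[OF G dec, of S] VH by (metis subset_trans)
    \<comment> \<open>All neighbours of \<open>v\<close> in \<open>S\<close> lie in one bag, so the
      strict bag bound is the degree bound for greedy colouring, with no extra colour
      needed.\<close>
    have "card {u \<in> S. v \<rightarrow>\<^bsub>G\<^esub> u} \<le> card (X t \<inter> verts H)"
      by (rule card_mono) (use finH v S in auto)
    then show "\<exists>v\<in>S. card {u \<in> S. v \<rightarrow>\<^bsub>G\<^esub> u} < (?w + 1) ^ ?k"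
      using bag[OF v(2)] v(1) by (meson le_less_trans)
  qed
  then have "\<exists>c. proper_colouring H ((?w + 1) ^ ?k) c"
    unfolding proper_colouring_def dominates_induced_subgraph_iff[OF H] by blast
  then show ?thesis
    unfolding chromatic_number_def by (rule Least_le)
qed

theorem mainTheorem13:
  fixes \<G> :: "('a, 'b) pre_digraph set" and k :: int
  assumes "\<And>G. G \<in> \<G> \<Longrightarrow> Digraph.graph G"
    and "\<And>G. G \<in> \<G> \<Longrightarrow> int (tree_alpha G) \<le> k"
  shows "\<exists>q :: real poly. \<forall>G\<in>\<G>. \<forall>G'. induced_subgraph G' G \<longrightarrow>
           real (chromatic_number G') \<le> poly q (real (clique_number G'))"
proof (intro exI ballI allI impI)
  fix G and G' :: "('a, 'b) pre_digraph"
  assume G: "G \<in> \<G>" and G': "induced_subgraph G' G"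
  have "chromatic_number G' \<le> (clique_number G' + 1) ^ tree_alpha G"
    using chromatic_number_induced_le[OF assms(1)[OF G] G'] .
  \<comment> \<open>The base is at least 1, so raising the exponent to \<open>nat k\<close> makes
    the bound uniform over the class.\<close>
  also have "\<dots> \<le> (clique_number G' + 1) ^ nat k"
    using assms(2)[OF G] by (intro power_increasing) auto
  finally have "real (chromatic_number G') \<le> real ((clique_number G' + 1) ^ nat k)"
    by (rule of_nat_mono)
  \<comment> \<open>The witness is the polynomial (1 + x)^k, which depends on \<open>k\<close>
    alone.\<close>
  then show "real (chromatic_number G') \<le> poly ([:1, 1:] ^ nat k) (real (clique_number G'))"
    by (simp add: add.commute)
qed

end
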